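(* Let $(X,\to,0,1)$ be an implicative-orthomodular algebra. The following hold for all $x,y,z\in X$: (1) $(z\Cap x)\to (y\Cap x)=(z\Cap x)\to y$; (2) $(x\to y)^*\Cap x=(x\to y)^*$; (3) $(x\Cap y)\Cap y=x\Cap y$; (4) $x\to (y\to z)=(x\odot y)\to z$; (5) $x\le_Q y\to z$ implies $x\odot y\le z$; (6) $x\odot y\le z$ implies $x\le y\to z$; (7) $(x\to y)\odot x\le y$; (8) $x\le_Q y$ implies $x\odot z\le_Q y\odot z$.
   Context: A BE algebra is an algebra $(X,\to,1)$ of type $(2,0)$ such that for all $x,y,z\in X$: $x\to x=1$; $x\to 1=1$; $1\to x=x$; $x\to(y\to z)=y\to(x\to z)$. Put $x\le y$ iff $x\to y=1$. It is bounded if there is $0\in X$ with $0\le x$ for all $x\in X$; then $x^*:=x\to 0$. It is involutive if it is bounded and $x^{**}=x$ for all $x$. In an involutive BE algebra $(X,\to,0,1)$ define $x\Cap y:=((x^*\to y^* )\to y^* )^*$, $x\odot y:=(x\to y^* )^*$, and $x\le_Q y$ iff $x=x\Cap y$. An implicative-orthomodular algebra is an involutive BE algebra satisfying $x\Cap(y\to x)=x$ for all $x,y\in X$. *)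

theory Defs
  imports Main
begin

record 'a be_struct =
  carrier :: "'a set"
  imp :: "['a, 'a] \<Rightarrow> 'a" (infixr \<open>\<rightarrow>\<index>\<close> 65)
  one :: 'a (\<open>\<one>\<index>\<close>)

record 'a bounded_be_struct = "'a be_struct" +
  zero :: 'a (\<open>\<zero>\<index>\<close>)

(* In a general BE algebra this relation need not be transitive or antisymmetric. *)
definition be_le :: "('a, 'm) be_struct_scheme \<Rightarrow> 'a \<Rightarrow> 'a \<Rightarrow> bool"
    (infix \<open>\<preceq>\<index>\<close> 50)
  where "x \<preceq>\<^bsub>A\<^esub> y \<longleftrightarrow> x \<rightarrow>\<^bsub>A\<^esub> y = \<one>\<^bsub>A\<^esub>"

definition be_neg :: "('a, 'm) bounded_be_struct_scheme \<Rightarrow> 'a \<Rightarrow> 'a"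
    (\<open>_\<^sup>\<star>\<index>\<close> [1000] 1000)
  where "x\<^sup>\<star>\<^bsub>A\<^esub> = x \<rightarrow>\<^bsub>A\<^esub> \<zero>\<^bsub>A\<^esub>"

(* Not a lattice meet: the operation is not commutative in general. *)
definition be_Cap :: "('a, 'm) bounded_be_struct_scheme \<Rightarrow> 'a \<Rightarrow> 'a \<Rightarrow> 'a"
    (infixl \<open>\<sqinter>\<index>\<close> 70)
  where "x \<sqinter>\<^bsub>A\<^esub> y = ((x\<^sup>\<star>\<^bsub>A\<^esub> \<rightarrow>\<^bsub>A\<^esub> y\<^sup>\<star>\<^bsub>A\<^esub>) \<rightarrow>\<^bsub>A\<^esub> y\<^sup>\<star>\<^bsub>A\<^esub>)\<^sup>\<star>\<^bsub>A\<^esub>"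

definition be_odot :: "('a, 'm) bounded_be_struct_scheme \<Rightarrow> 'a \<Rightarrow> 'a \<Rightarrow> 'a"
    (infixl \<open>\<odot>\<index>\<close> 70)
  where "x \<odot>\<^bsub>A\<^esub> y = (x \<rightarrow>\<^bsub>A\<^esub> y\<^sup>\<star>\<^bsub>A\<^esub>)\<^sup>\<star>\<^bsub>A\<^esub>"

definition be_le_Q :: "('a, 'm) bounded_be_struct_scheme \<Rightarrow> 'a \<Rightarrow> 'a \<Rightarrow> bool"
    (infix \<open>\<preceq>\<^sub>Q\<index>\<close> 50)
  where "x \<preceq>\<^sub>Q\<^bsub>A\<^esub> y \<longleftrightarrow> x = x \<sqinter>\<^bsub>A\<^esub> y"

locale be_algebra =
  fixes A (structure)
  assumes imp_closed: "\<lbrakk>x \<in> carrier A; y \<in> carrier A\<rbrakk> \<Longrightarrow> x \<rightarrow> y \<in> carrier A"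
    and one_closed: "\<one> \<in> carrier A"
    and imp_self: "x \<in> carrier A \<Longrightarrow> x \<rightarrow> x = \<one>"
    and imp_one: "x \<in> carrier A \<Longrightarrow> x \<rightarrow> \<one> = \<one>"
    and one_imp: "x \<in> carrier A \<Longrightarrow> \<one> \<rightarrow> x = x"
    and imp_exchange: "\<lbrakk>x \<in> carrier A; y \<in> carrier A; z \<in> carrier A\<rbrakk>
      \<Longrightarrow> x \<rightarrow> (y \<rightarrow> z) = y \<rightarrow> (x \<rightarrow> z)"

locale bounded_be_algebra = be_algebra A
  for A :: "('a, 'm) bounded_be_struct_scheme" (structure) +
  assumes zero_closed: "\<zero> \<in> carrier A"
    and zero_le: "x \<in> carrier A \<Longrightarrow> \<zero> \<preceq> x"

locale involutive_be_algebra = bounded_be_algebra +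
  assumes neg_neg: "x \<in> carrier A \<Longrightarrow> x\<^sup>\<star>\<^sup>\<star> = x"

locale implicative_orthomodular_algebra = involutive_be_algebra +
  assumes Cap_imp: "\<lbrakk>x \<in> carrier A; y \<in> carrier A\<rbrakk> \<Longrightarrow> x \<sqinter> (y \<rightarrow> x) = x"

end

theory Submission
  imports Defs
begin

text \<open>
  In an involutive BE algebra, \<open>\<odot>\<close> is commutative and associative, and it is tied to the
  implication by the currying law \<open>x \<odot> y \<rightarrow> z = x \<rightarrow> (y \<rightarrow> z)\<close>. Both rest on the exchange law,
  which together with \<open>x\<^sup>\<star>\<^sup>\<star> = x\<close> yields contraposition. In these terms
  \<open>x \<sqinter> y = (y \<rightarrow> x) \<odot> y\<close>, so \<open>x \<preceq>\<^sub>Q y\<close> says that \<open>y\<close> divides \<open>x\<close> with quotient \<open>y \<rightarrow> x\<close>.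

  The orthomodular axiom is \<open>x \<preceq>\<^sub>Q y \<rightarrow> x\<close>. It makes negation reverse \<open>\<preceq>\<^sub>Q\<close>: if
  \<open>x = (y \<rightarrow> x) \<odot> y\<close>, then \<open>x\<^sup>\<star>\<close> is an implication with conclusion \<open>y\<^sup>\<star>\<close>, to which the axiom
  applies. Dualizing the axiom itself then gives \<open>u \<odot> v \<preceq>\<^sub>Q v\<close>, so that \<open>\<preceq>\<^sub>Q\<close> is exactly
  divisibility for \<open>\<odot>\<close>. The claims on \<open>\<preceq>\<^sub>Q\<close> are statements about divisibility, and those on
  \<open>\<preceq>\<close> follow by currying. The first identity combines currying with
  \<open>x \<rightarrow> (y \<sqinter> x) = x \<rightarrow> y\<close>, which is the negation of \<open>(x \<odot> y\<^sup>\<star>) \<sqinter> x = x \<odot> y\<^sup>\<star>\<close>.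
\<close>

context involutive_be_algebra
begin

lemma neg_closed: "x \<in> carrier A \<Longrightarrow> x\<^sup>\<star> \<in> carrier A"
  by (simp add: be_neg_def imp_closed zero_closed)

lemma odot_closed: "\<lbrakk>x \<in> carrier A; y \<in> carrier A\<rbrakk> \<Longrightarrow> x \<odot> y \<in> carrier A"
  by (simp add: be_odot_def imp_closed neg_closed)

lemma imp_neg_commute:
  assumes "x \<in> carrier A" "y \<in> carrier A"
  shows "x \<rightarrow> y\<^sup>\<star> = y \<rightarrow> x\<^sup>\<star>"
  using assms by (simp add: be_neg_def imp_exchange zero_closed)

lemma contraposition:
  assumes "x \<in> carrier A" "y \<in> carrier A"
  shows "y\<^sup>\<star> \<rightarrow> x\<^sup>\<star> = x \<rightarrow> y"
  using imp_neg_commute[of x "y\<^sup>\<star>"] assms by (simp add: neg_closed neg_neg)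

lemma odot_commute:
  assumes "x \<in> carrier A" "y \<in> carrier A"
  shows "x \<odot> y = y \<odot> x"
  using imp_neg_commute[OF assms] by (simp add: be_odot_def)

lemma neg_odot:
  assumes "x \<in> carrier A" "y \<in> carrier A"
  shows "(x \<odot> y)\<^sup>\<star> = x \<rightarrow> y\<^sup>\<star>"
  using assms by (simp add: be_odot_def imp_closed neg_closed neg_neg)

lemma neg_imp:
  assumes "x \<in> carrier A" "y \<in> carrier A"
  shows "(x \<rightarrow> y)\<^sup>\<star> = x \<odot> y\<^sup>\<star>"
  using assms by (simp add: be_odot_def neg_neg)

text \<open>
  Contraposition turns \<open>x \<odot> y \<rightarrow> z\<close> into \<open>z\<^sup>\<star> \<rightarrow> (x \<rightarrow> y\<^sup>\<star>)\<close>; exchanging \<open>z\<^sup>\<star>\<close> with \<open>x\<close> and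
  contraposing the inner implication gives the curried form.
\<close>

lemma odot_imp:
  assumes "x \<in> carrier A" "y \<in> carrier A" "z \<in> carrier A"
  shows "x \<odot> y \<rightarrow> z = x \<rightarrow> (y \<rightarrow> z)"
proof -
  have "x \<odot> y \<rightarrow> z = z\<^sup>\<star> \<rightarrow> (x \<rightarrow> y\<^sup>\<star>)"
    using contraposition[of "x \<odot> y" z] assms by (simp add: neg_odot odot_closed)
  also have "\<dots> = x \<rightarrow> (z\<^sup>\<star> \<rightarrow> y\<^sup>\<star>)"
    using assms by (simp add: imp_exchange neg_closed)
  also have "\<dots> = x \<rightarrow> (y \<rightarrow> z)"
    using assms by (simp add: contraposition)
  finally show ?thesis .
qed

lemma odot_assoc:
  assumes "x \<in> carrier A" "y \<in> carrier A" "z \<in> carrier A"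
  shows "(x \<odot> y) \<odot> z = x \<odot> (y \<odot> z)"
proof -
  have "(x \<odot> y) \<odot> z = (x \<rightarrow> (y \<rightarrow> z\<^sup>\<star>))\<^sup>\<star>"
    using assms by (simp add: be_odot_def[of A "x \<odot> y" z] odot_imp neg_closed)
  also have "\<dots> = x \<odot> (y \<odot> z)"
    using assms by (simp add: be_odot_def[of A x "y \<odot> z"] neg_odot)
  finally show ?thesis .
qed

lemma Cap_eq_odot:
  assumes "x \<in> carrier A" "y \<in> carrier A"
  shows "x \<sqinter> y = (y \<rightarrow> x) \<odot> y"
  using assms by (simp add: be_Cap_def be_odot_def contraposition)

lemma le_Q_iff_odot:
  assumes "x \<in> carrier A" "y \<in> carrier A"
  shows "x \<preceq>\<^sub>Q y \<longleftrightarrow> x = (y \<rightarrow> x) \<odot> y"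
  using assms by (simp add: be_le_Q_def Cap_eq_odot)

lemma le_Q_imp_le:
  assumes "x \<in> carrier A" "y \<in> carrier A" and "x \<preceq>\<^sub>Q y"
  shows "x \<preceq> y"
proof -
  have "x \<rightarrow> y = (y \<rightarrow> x) \<odot> y \<rightarrow> y"
    using assms le_Q_iff_odot by simp
  also have "\<dots> = \<one>"
    using assms(1,2) by (simp add: odot_imp imp_closed imp_self imp_one)
  finally show ?thesis
    by (simp add: be_le_def)
qed

lemma modus_ponens_le:
  assumes "x \<in> carrier A" "y \<in> carrier A"
  shows "(x \<rightarrow> y) \<odot> x \<preceq> y"
  using assms by (simp add: be_le_def odot_imp imp_closed imp_self)

end

context implicative_orthomodular_algebra
begin

text \<open>
  Negating \<open>x = (y \<rightarrow> x) \<odot> y\<close> exhibits \<open>x\<^sup>\<star>\<close> as \<open>(y \<rightarrow> x) \<rightarrow> y\<^sup>\<star>\<close>, and every element lies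
  \<open>\<preceq>\<^sub>Q\<close>-below any implication of which it is the conclusion.
\<close>

lemma le_Q_antitone_neg:
  assumes "x \<in> carrier A" "y \<in> carrier A" and "x \<preceq>\<^sub>Q y"
  shows "y\<^sup>\<star> \<preceq>\<^sub>Q x\<^sup>\<star>"
proof -
  have "x\<^sup>\<star> = ((y \<rightarrow> x) \<odot> y)\<^sup>\<star>"
    using assms le_Q_iff_odot by simp
  also have "\<dots> = (y \<rightarrow> x) \<rightarrow> y\<^sup>\<star>"
    using assms(1,2) by (simp add: neg_odot imp_closed)
  finally show ?thesis
    using assms(1,2) by (simp add: be_le_Q_def Cap_imp imp_closed neg_closed)
qed

text \<open>This is the dual of the orthomodular axiom \<open>y\<^sup>\<star> \<preceq>\<^sub>Q x \<rightarrow> y\<^sup>\<star>\<close>.\<close>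

lemma odot_le_Q:
  assumes "x \<in> carrier A" "y \<in> carrier A"
  shows "x \<odot> y \<preceq>\<^sub>Q y"
proof -
  have "y\<^sup>\<star> \<preceq>\<^sub>Q x \<rightarrow> y\<^sup>\<star>"
    using assms by (simp add: be_le_Q_def Cap_imp neg_closed)
  then have "(x \<rightarrow> y\<^sup>\<star>)\<^sup>\<star> \<preceq>\<^sub>Q y\<^sup>\<star>\<^sup>\<star>"
    using assms by (simp add: le_Q_antitone_neg imp_closed neg_closed)
  then show ?thesis
    using assms by (simp add: be_odot_def neg_neg)
qed

lemma neg_imp_le_Q:
  assumes "x \<in> carrier A" "y \<in> carrier A"
  shows "(x \<rightarrow> y)\<^sup>\<star> \<preceq>\<^sub>Q x"
  using odot_le_Q[of "y\<^sup>\<star>" x] assms by (simp add: neg_imp odot_commute neg_closed)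

lemma Cap_le_Q:
  assumes "x \<in> carrier A" "y \<in> carrier A"
  shows "x \<sqinter> y \<preceq>\<^sub>Q y"
  using assms by (simp add: Cap_eq_odot odot_le_Q imp_closed)

text \<open>
  Negated, the left-hand side becomes \<open>x \<odot> (x \<rightarrow> x \<odot> y\<^sup>\<star>)\<close>, the multiple of \<open>x\<close> recovered from
  its own quotient; \<open>x \<odot> y\<^sup>\<star> \<preceq>\<^sub>Q x\<close> identifies it with \<open>x \<odot> y\<^sup>\<star> = (x \<rightarrow> y)\<^sup>\<star>\<close>.
\<close>

lemma imp_Cap:
  assumes x: "x \<in> carrier A" and y: "y \<in> carrier A"
  shows "x \<rightarrow> (y \<sqinter> x) = x \<rightarrow> y"
proof -
  let ?q = "(x \<rightarrow> y)\<^sup>\<star>"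
  have [simp]: "x \<rightarrow> y \<in> carrier A" "?q \<in> carrier A" "x \<rightarrow> ?q \<in> carrier A"
    using x y by (simp_all add: imp_closed neg_closed)
  have "y \<sqinter> x = (x \<rightarrow> ?q)\<^sup>\<star>"
    using x y by (simp add: Cap_eq_odot be_odot_def imp_neg_commute)
  then have "x \<rightarrow> (y \<sqinter> x) = ((x \<rightarrow> ?q) \<odot> x)\<^sup>\<star>"
    using x by (simp add: neg_odot imp_neg_commute)
  also have "(x \<rightarrow> ?q) \<odot> x = ?q"
    using neg_imp_le_Q[OF x y] x le_Q_iff_odot[of ?q x] by simp
  finally show ?thesis
    by (simp add: neg_neg)
qed

text \<open>
  Writing \<open>p = (x \<rightarrow> p) \<odot> x\<close> and currying replaces the premise \<open>p\<close> by \<open>x \<rightarrow> p\<close> followed by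
  \<open>x\<close>, and under the premise \<open>x\<close> the elements \<open>y \<sqinter> x\<close> and \<open>y\<close> cannot be told apart.
\<close>

lemma le_Q_imp_Cap:
  assumes "p \<in> carrier A" "x \<in> carrier A" "y \<in> carrier A" and "p \<preceq>\<^sub>Q x"
  shows "p \<rightarrow> (y \<sqinter> x) = p \<rightarrow> y"
proof -
  have curry: "p \<rightarrow> u = (x \<rightarrow> p) \<rightarrow> (x \<rightarrow> u)" if "u \<in> carrier A" for u
  proof -
    have "p = (x \<rightarrow> p) \<odot> x"
      using assms le_Q_iff_odot by simp
    then have "p \<rightarrow> u = (x \<rightarrow> p) \<odot> x \<rightarrow> u"
      by simp
    then show ?thesis
      using assms(1,2) that by (simp add: odot_imp imp_closed)
  qed
  have "y \<sqinter> x \<in> carrier A"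
    using assms by (simp add: Cap_eq_odot odot_closed imp_closed)
  then show ?thesis
    using assms by (simp add: curry imp_Cap)
qed

text \<open>If \<open>y\<close> divides \<open>x\<close>, then \<open>y \<odot> z\<close> divides \<open>x \<odot> z\<close> with the same quotient.\<close>

lemma odot_mono_le_Q:
  assumes "x \<in> carrier A" "y \<in> carrier A" "z \<in> carrier A" and "x \<preceq>\<^sub>Q y"
  shows "x \<odot> z \<preceq>\<^sub>Q y \<odot> z"
proof -
  have "x \<odot> z = ((y \<rightarrow> x) \<odot> y) \<odot> z"
    using assms le_Q_iff_odot by simp
  also have "\<dots> = (y \<rightarrow> x) \<odot> (y \<odot> z)"
    using assms by (simp add: odot_assoc imp_closed)
  finally show ?thesis
    using assms by (simp add: odot_le_Q imp_closed odot_closed)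
qed

end

theorem proposition3p10:
  fixes A :: "('a, 'm) bounded_be_struct_scheme" (structure)
    and x y z :: 'a
  assumes "implicative_orthomodular_algebra A"
    and "x \<in> carrier A" and "y \<in> carrier A" and "z \<in> carrier A"
  shows
    "((z \<sqinter> x) \<rightarrow> (y \<sqinter> x) = (z \<sqinter> x) \<rightarrow> y)
     \<and> ((x \<rightarrow> y)\<^sup>\<star> \<sqinter> x = (x \<rightarrow> y)\<^sup>\<star>)
     \<and> ((x \<sqinter> y) \<sqinter> y = x \<sqinter> y)
     \<and> (x \<rightarrow> (y \<rightarrow> z) = (x \<odot> y) \<rightarrow> z)
     \<and> (x \<preceq>\<^sub>Q (y \<rightarrow> z) \<longrightarrow> (x \<odot> y) \<preceq> z)
     \<and> ((x \<odot> y) \<preceq> z \<longrightarrow> x \<preceq> (y \<rightarrow> z))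
     \<and> (((x \<rightarrow> y) \<odot> x) \<preceq> y)
     \<and> (x \<preceq>\<^sub>Q y \<longrightarrow> (x \<odot> z) \<preceq>\<^sub>Q (y \<odot> z))"
proof -
  interpret implicative_orthomodular_algebra A
    by fact
  note x = assms(2) and y = assms(3) and z = assms(4)
  have "z \<sqinter> x \<in> carrier A"
    using x z by (simp add: Cap_eq_odot odot_closed imp_closed)
  then have "(z \<sqinter> x) \<rightarrow> (y \<sqinter> x) = (z \<sqinter> x) \<rightarrow> y"
    using x y z by (simp add: le_Q_imp_Cap Cap_le_Q)
  moreover have "(x \<rightarrow> y)\<^sup>\<star> \<sqinter> x = (x \<rightarrow> y)\<^sup>\<star>"
    using neg_imp_le_Q[OF x y] by (simp add: be_le_Q_def)
  moreover have "(x \<sqinter> y) \<sqinter> y = x \<sqinter> y"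
    using Cap_le_Q[OF x y] by (simp add: be_le_Q_def)
  moreover have curry: "x \<rightarrow> (y \<rightarrow> z) = (x \<odot> y) \<rightarrow> z"
    using x y z by (simp add: odot_imp)
  moreover have "x \<preceq>\<^sub>Q (y \<rightarrow> z) \<longrightarrow> (x \<odot> y) \<preceq> z"
    using le_Q_imp_le[OF x imp_closed[OF y z]] curry by (simp add: be_le_def)
  moreover have "(x \<odot> y) \<preceq> z \<longrightarrow> x \<preceq> (y \<rightarrow> z)"
    using curry by (simp add: be_le_def)
  moreover have "((x \<rightarrow> y) \<odot> x) \<preceq> y"
    using x y by (rule modus_ponens_le)
  moreover have "x \<preceq>\<^sub>Q y \<longrightarrow> (x \<odot> z) \<preceq>\<^sub>Q (y \<odot> z)"
    using odot_mono_le_Q[OF x y z] by blast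
  ultimately show ?thesis
    by blast
qed

end
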